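(* Let $a_{ij},b_{ij}\in\mathbb{R}$ ($i,j\in\{1,2\}$) and for $\varphi\in\mathbb{R}$ let $$A(\varphi)=\begin{pmatrix}a_{11}+b_{11}\varphi & a_{12}+b_{12}\varphi\\ a_{21}+b_{21}\varphi & a_{22}+b_{22}\varphi\end{pmatrix}.$$ Assume that there exists a value $\varphi^*$ such that $A(\varphi^* )$ is the $2\times2$ identity matrix. Then, when clouds of points in the plane with linear coefficients $M,H$ are transformed under the invertible matrices $A(\varphi)$, a family of cloud invariants is $$I(M,H)=F\left(\frac{M^2-H}{\bigl(b_{12}H-b_{21}+(b_{11}-b_{22})M\bigr)^2}\right),$$ where $F(\cdot)$ is an arbitrary real valued function.
   Context: A cloud of points is a finite family $(x_i,y_i)\in\mathbb{R}^2$, $i=1,\dots,N$. Its linear coefficients are $$M=\frac{N\sum_{i=1}^N x_iy_i-\sum_{i=1}^N x_i\sum_{i=1}^N y_i}{N\sum_{i=1}^N x_i^2-\left(\sum_{i=1}^N x_i\right)^2},\qquad H=\frac{N\sum_{i=1}^N y_i^2-\left(\sum_{i=1}^N y_i\right)^2}{N\sum_{i=1}^N x_i^2-\left(\sum_{i=1}^N x_i\right)^2},$$ understood to be defined (nonzero denominator) whenever mentioned. The transformation of the cloud under a $2\times2$ matrix $A$ is the cloud $(\hat x_i,\hat y_i)$ with $\begin{pmatrix}\hat x_i\\ \hat y_i\end{pmatrix}=A\begin{pmatrix}x_i\\ y_i\end{pmatrix}$; $\hat M,\hat H$ denote its linear coefficients. For $A=\begin{pmatrix}\alpha&\beta\\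 \gamma&\delta\end{pmatrix}$, $$\hat M=\frac{(\alpha\delta+\beta\gamma)M+\beta\delta H+\alpha\gamma}{2\alpha\beta M+\beta^2H+\alpha^2},\qquad \hat H=\frac{2\gamma\delta M+\delta^2H+\gamma^2}{2\alpha\beta M+\beta^2H+\alpha^2}.$$ A function $I$ of $(M,H)$ is a cloud invariant for a given set of matrices if $I(\hat M,\hat H)=I(M,H)$ for every cloud and every matrix $A$ of the set, whenever both sides are defined. The set of matrices $A(\varphi)$ is not required to be a group. *)

theory Defs
  imports "HOL-Analysis.Analysis"
begin

text \<open>A cloud of \<open>N\<close> points is given by \<open>p :: nat \<Rightarrow> real^2\<close>, of which only the values at
  \<open>1, \<dots>, N\<close> are used; the \<open>i\<close>-th point is \<open>(x\<^sub>i, y\<^sub>i) = (p i $ 1, p i $ 2)\<close>.\<close>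

definition cloud_denom :: "nat \<Rightarrow> (nat \<Rightarrow> real^2) \<Rightarrow> real" where
  "cloud_denom N p = real N * (\<Sum>i=1..N. (p i $ 1)\<^sup>2) - (\<Sum>i=1..N. p i $ 1)\<^sup>2"

definition coeff_M :: "nat \<Rightarrow> (nat \<Rightarrow> real^2) \<Rightarrow> real" where
  "coeff_M N p =
     (real N * (\<Sum>i=1..N. p i $ 1 * p i $ 2) - (\<Sum>i=1..N. p i $ 1) * (\<Sum>i=1..N. p i $ 2))
       / cloud_denom N p"

definition coeff_H :: "nat \<Rightarrow> (nat \<Rightarrow> real^2) \<Rightarrow> real" where
  "coeff_H N p =
     (real N * (\<Sum>i=1..N. (p i $ 2)\<^sup>2) - (\<Sum>i=1..N. p i $ 2)\<^sup>2) / cloud_denom N p"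

definition transform_cloud :: "real^2^2 \<Rightarrow> (nat \<Rightarrow> real^2) \<Rightarrow> (nat \<Rightarrow> real^2)" where
  "transform_cloud A p = (\<lambda>i. A *v p i)"

text \<open>\<open>D\<close> is the domain of the partial function \<open>I\<close> of \<open>(M, H)\<close>. The hypotheses below say exactly
  that both sides of the equation are defined.\<close>

definition cloud_invariant ::
  "(real^2^2) set \<Rightarrow> (real \<times> real) set \<Rightarrow> (real \<Rightarrow> real \<Rightarrow> real) \<Rightarrow> bool" where
  "cloud_invariant \<A> D I \<longleftrightarrow>
     (\<forall>N p. \<forall>A\<in>\<A>.
        cloud_denom N p \<noteq> 0 \<longrightarrow>
        cloud_denom N (transform_cloud A p) \<noteq> 0 \<longrightarrow>
        (coeff_M N p, coeff_H N p) \<in> D \<longrightarrow>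
        (coeff_M N (transform_cloud A p), coeff_H N (transform_cloud A p)) \<in> D \<longrightarrow>
        I (coeff_M N (transform_cloud A p)) (coeff_H N (transform_cloud A p))
          = I (coeff_M N p) (coeff_H N p))"

definition affine_matrix :: "real^2^2 \<Rightarrow> real^2^2 \<Rightarrow> real \<Rightarrow> real^2^2" where
  "affine_matrix a b \<phi> = (\<chi> i j. a $ i $ j + b $ i $ j * \<phi>)"

end

(* Since A(phi0) is the identity, A(phi) = 1 + t b with t = phi - phi0, so A = A(phi) commutes
   with b.  Let U, V, W be the moments of the cloud, so that M = V/U and H = W/U.  The symmetric
   matrix of moments is transformed to A S A^T, hence V^2 - U W is multiplied by (det A)^2.  The
   form L = b12 W - b21 U + (b11 - b22) V is the moment of the quadratic form v -> -det(v, b v),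
   and det(A v, b A v) = det(A v, A b v) = det A * det(v, b v), so L is multiplied by det A.
   The argument of F is (V^2 - U W) / L^2. *)
theory Submission
  imports Defs
begin

text \<open>This is N^2 times the empirical covariance, a symmetric bilinear form. With it the
  numerators of M and H and their common denominator get one uniform shape.\<close>

definition moment :: "nat \<Rightarrow> (nat \<Rightarrow> real) \<Rightarrow> (nat \<Rightarrow> real) \<Rightarrow> real" where
  "moment N f g = real N * (\<Sum>i=1..N. f i * g i) - (\<Sum>i=1..N. f i) * (\<Sum>i=1..N. g i)"

lemma moment_commute: "moment N f g = moment N g f"
  by (simp add: moment_def mult.commute)

lemma moment_linear_left:
  "moment N (\<lambda>i. r * f i + s * g i) h = r * moment N f h + s * moment N g h"
proof -
  have "(\<Sum>i=1..N. (r * f i + s * g i) * h i) = r * (\<Sum>i=1..N. f i * h i) + s * (\<Sum>i=1..N. g i * h i)"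
    by (simp add: distrib_right sum.distrib mult.assoc sum_distrib_left)
  moreover have "(\<Sum>i=1..N. r * f i + s * g i) = r * (\<Sum>i=1..N. f i) + s * (\<Sum>i=1..N. g i)"
    by (simp add: sum.distrib sum_distrib_left)
  ultimately show ?thesis
    unfolding moment_def by algebra
qed

lemma moment_linear_combinations:
  "moment N (\<lambda>i. p * f i + q * g i) (\<lambda>i. r * f i + s * g i) =
     p * r * moment N f f + (p * s + q * r) * moment N f g + q * s * moment N g g"
proof -
  have "moment N h (\<lambda>i. r * f i + s * g i) = r * moment N f h + s * moment N g h" for h
    by (subst moment_commute) (rule moment_linear_left)
  then show ?thesis
    by (simp add: moment_linear_left moment_commute[of N g f] algebra_simps)
qed

lemma cloud_denom_eq_moment:
  "cloud_denom N p = moment N (\<lambda>i. p i $ 1) (\<lambda>i. p i $ 1)"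
  by (simp add: cloud_denom_def moment_def power2_eq_square)

lemma coeff_M_eq_moment:
  "coeff_M N p = moment N (\<lambda>i. p i $ 1) (\<lambda>i. p i $ 2) / moment N (\<lambda>i. p i $ 1) (\<lambda>i. p i $ 1)"
  by (simp add: coeff_M_def cloud_denom_eq_moment moment_def)

lemma coeff_H_eq_moment:
  "coeff_H N p = moment N (\<lambda>i. p i $ 2) (\<lambda>i. p i $ 2) / moment N (\<lambda>i. p i $ 1) (\<lambda>i. p i $ 1)"
  by (simp add: coeff_H_def cloud_denom_eq_moment moment_def power2_eq_square)

lemma transform_cloud_nth:
  "transform_cloud A p i $ k = A $ k $ 1 * p i $ 1 + A $ k $ 2 * p i $ 2"
  by (simp add: transform_cloud_def matrix_vector_mult_def sum_2)

text \<open>By bilinearity this is entry (k, l) of A S A^T, where S is the matrix of moments; the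
  two off-diagonal entries of S are merged by symmetry.\<close>

lemma moment_transform_cloud:
  "moment N (\<lambda>i. transform_cloud A p i $ k) (\<lambda>i. transform_cloud A p i $ l) =
     A $ k $ 1 * A $ l $ 1 * moment N (\<lambda>i. p i $ 1) (\<lambda>i. p i $ 1) +
     (A $ k $ 1 * A $ l $ 2 + A $ k $ 2 * A $ l $ 1) * moment N (\<lambda>i. p i $ 1) (\<lambda>i. p i $ 2) +
     A $ k $ 2 * A $ l $ 2 * moment N (\<lambda>i. p i $ 2) (\<lambda>i. p i $ 2)"
  unfolding transform_cloud_nth by (rule moment_linear_combinations)

text \<open>Eliminates \<open>a\<close>, so that only \<open>b\<close> and the shift of the
  parameter remain.\<close>

lemma affine_matrix_eq_mat_1:
  assumes "affine_matrix a b \<phi>\<^sub>0 = mat 1"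
  shows "affine_matrix a b \<phi> = mat 1 + (\<phi> - \<phi>\<^sub>0) *\<^sub>R b"
proof -
  have "a $ i $ j + b $ i $ j * \<phi>\<^sub>0 = mat 1 $ i $ j" for i j
    using arg_cong[OF assms, of "\<lambda>X. X $ i $ j"] by (simp add: affine_matrix_def)
  then have "a $ i $ j + b $ i $ j * \<phi> = mat 1 $ i $ j + (\<phi> - \<phi>\<^sub>0) * b $ i $ j" for i j
    \<comment> \<open>Entries of \<open>mat 1\<close> are rewritten back into those of
      \<open>a\<close> and \<open>b\<close>, which avoids a case split on i = j.\<close>
    by (simp add: algebra_simps flip: \<open>\<And>i j. _ = mat 1 $ i $ j\<close>)
  then show ?thesis
    by (simp add: vec_eq_iff affine_matrix_def)
qed

text \<open>With M = V/U and H = W/U, the numerator and the squared form both carry the factor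
  1/U^2, which cancels. If the form vanishes, both sides are 0, as division by zero gives 0.\<close>

lemma quotient_homogeneous:
  fixes U V W r s q :: real
  assumes "U \<noteq> 0"
  shows "((V / U)\<^sup>2 - W / U) / (r * (W / U) - s + q * (V / U))\<^sup>2 =
    (V\<^sup>2 - U * W) / (r * W - s * U + q * V)\<^sup>2"
proof -
  have "(V / U)\<^sup>2 - W / U = (V\<^sup>2 - U * W) / U\<^sup>2"
    and "r * (W / U) - s + q * (V / U) = (r * W - s * U + q * V) / U"
    using assms by (simp_all add: field_simps power2_eq_square)
  then show ?thesis
    using assms by (simp add: power_divide)
qed

theorem mainTheorem7:
  fixes a b :: "real^2^2" and F :: "real \<Rightarrow> real"
  assumes "\<exists>\<phi>\<^sub>0. affine_matrix a b \<phi>\<^sub>0 = mat 1"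
  shows "cloud_invariant
           {affine_matrix a b \<phi> | \<phi>. invertible (affine_matrix a b \<phi>)}
           {(M, H). b $ 1 $ 2 * H - b $ 2 $ 1 + (b $ 1 $ 1 - b $ 2 $ 2) * M \<noteq> 0}
           (\<lambda>M H. F ((M\<^sup>2 - H) /
              (b $ 1 $ 2 * H - b $ 2 $ 1 + (b $ 1 $ 1 - b $ 2 $ 2) * M)\<^sup>2))"
proof -
  obtain \<phi>\<^sub>0 where \<phi>\<^sub>0: "affine_matrix a b \<phi>\<^sub>0 = mat 1"
    using assms by blast
  \<comment> \<open>It suffices that the argument of \<open>F\<close> is preserved.\<close>
  let ?q = "\<lambda>M H. (M\<^sup>2 - H) / (b $ 1 $ 2 * H - b $ 2 $ 1 + (b $ 1 $ 1 - b $ 2 $ 2) * M)\<^sup>2"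
  have "?q (coeff_M N (transform_cloud A p)) (coeff_H N (transform_cloud A p)) =
      ?q (coeff_M N p) (coeff_H N p)"
    if A: "A = affine_matrix a b \<phi>" "invertible A"
      and nz: "cloud_denom N p \<noteq> 0" "cloud_denom N (transform_cloud A p) \<noteq> 0" for N p A \<phi>
  proof -
    define t where "t = \<phi> - \<phi>\<^sub>0"
    define U V W where "U = moment N (\<lambda>i. p i $ 1) (\<lambda>i. p i $ 1)"
      and "V = moment N (\<lambda>i. p i $ 1) (\<lambda>i. p i $ 2)"
      and "W = moment N (\<lambda>i. p i $ 2) (\<lambda>i. p i $ 2)"
    let ?m = "\<lambda>k l. moment N (\<lambda>i. transform_cloud A p i $ k) (\<lambda>i. transform_cloud A p i $ l)"
    have m: "?m k l = A $ k $ 1 * A $ l $ 1 * U + (A $ k $ 1 * A $ l $ 2 + A $ k $ 2 * A $ l $ 1) * V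
        + A $ k $ 2 * A $ l $ 2 * W" for k l
      unfolding U_def V_def W_def by (rule moment_transform_cloud)
    have A_nth: "A $ 1 $ 1 = 1 + t * b $ 1 $ 1" "A $ 1 $ 2 = t * b $ 1 $ 2"
      "A $ 2 $ 1 = t * b $ 2 $ 1" "A $ 2 $ 2 = 1 + t * b $ 2 $ 2"
      using A(1) affine_matrix_eq_mat_1[OF \<phi>\<^sub>0, of \<phi>] by (simp_all add: t_def mat_def)
    have det: "det A \<noteq> 0"
      using A(2) by (simp add: invertible_det_nz)
    \<comment> \<open>This is det (A S A^T) = (det A)^2 det S with both signs reversed, valid for
      any matrix A.\<close>
    have disc: "(?m 1 2)\<^sup>2 - ?m 1 1 * ?m 2 2 = (det A)\<^sup>2 * (V\<^sup>2 - U * W)"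
      unfolding m det_2 by algebra
    \<comment> \<open>Here the shape A = 1 + t b enters: after substitution of \<open>A_nth\<close>
      this is a polynomial identity in t, the entries of \<open>b\<close>, and U, V, W.\<close>
    have form: "b $ 1 $ 2 * ?m 2 2 - b $ 2 $ 1 * ?m 1 1 + (b $ 1 $ 1 - b $ 2 $ 2) * ?m 1 2 =
        det A * (b $ 1 $ 2 * W - b $ 2 $ 1 * U + (b $ 1 $ 1 - b $ 2 $ 2) * V)"
      unfolding m det_2 A_nth by algebra
    have "U \<noteq> 0" "?m 1 1 \<noteq> 0"
      using nz by (simp_all add: U_def cloud_denom_eq_moment)
    \<comment> \<open>The numerator and the squared form both gain (det A)^2, which cancels since A
      is invertible.\<close>
    then show ?thesis
      using det
      unfolding coeff_M_eq_moment coeff_H_eq_moment U_def[symmetric] V_def[symmetric] W_def[symmetric]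
        quotient_homogeneous[OF \<open>U \<noteq> 0\<close>] quotient_homogeneous[OF \<open>?m 1 1 \<noteq> 0\<close>] disc form
      by (simp add: power_mult_distrib)
  qed
  then show ?thesis
    unfolding cloud_invariant_def by auto
qed

end
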